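(* Let $f$ and $g$ be two integrable functions on $[0,\infty)$ and let $m,M,p,P\in\mathbb{R}$ be such that $$m\le f(x)\le M,\qquad p\le g(x)\le P\qquad\text{for all } x\in[0,\infty).$$ Then for all $\beta,\kappa\in\mathbb{R}$, $x>0$, $\alpha>0$, $\rho>0$ and $\eta\ge 0$, $$\Bigl|\Lambda_{x,\kappa}^{\rho,\beta}(\alpha,\eta)\;{}^{\rho}\mathcal{I}_{\eta,\kappa}^{\alpha,\beta}(fg)(x)-{}^{\rho}\mathcal{I}_{\eta,\kappa}^{\alpha,\beta}f(x)\;{}^{\rho}\mathcal{I}_{\eta,\kappa}^{\alpha,\beta}g(x)\Bigr|\le\bigl(\Lambda_{x,\kappa}^{\rho,\beta}(\alpha,\eta)\bigr)^{2}(M-m)(P-p).$$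
   Context: For a function $\varphi$ on $[0,\infty)$, the (left-sided, based at $0$) Katugampola fractional integral is $${}^{\rho}\mathcal{I}_{\eta,\kappa}^{\alpha,\beta}\varphi(x)=\frac{\rho^{1-\beta}x^{\kappa}}{\Gamma(\alpha)}\int_{0}^{x}\frac{\tau^{\rho(\eta+1)-1}}{(x^{\rho}-\tau^{\rho})^{1-\alpha}}\varphi(\tau)\,d\tau,\qquad x>0,$$ whenever the integral exists. Moreover $$\Lambda_{x,\kappa}^{\rho,\beta}(\alpha,\eta)=\frac{\Gamma(\eta+1)}{\Gamma(\eta+\alpha+1)}\rho^{-\beta}x^{\kappa+\rho(\eta+\alpha)}.$$ Here $fg$ denotes the pointwise product. *)

theory Defs
  imports "HOL-Analysis.Analysis"
begin

text \<open>
  The integral is a Lebesgue integral. The values of the kernel at the endpoints 0 and x, where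
  \<^const>\<open>powr\<close> takes the conventional value 0, lie in a null set. If the integrand is not
  integrable, the right-hand side is 0 by the library's convention; for bounded measurable \<phi> and
  positive \<alpha>, \<rho>, \<eta> + 1, the integral always exists.
\<close>

definition katugampola_integral ::
  "real \<Rightarrow> real \<Rightarrow> real \<Rightarrow> real \<Rightarrow> real \<Rightarrow> (real \<Rightarrow> real) \<Rightarrow> real \<Rightarrow> real" where
  "katugampola_integral \<rho> \<alpha> \<beta> \<eta> \<kappa> \<phi> x =
     \<rho> powr (1 - \<beta>) * x powr \<kappa> / Gamma \<alpha> *
     (LINT \<tau>:{0..x}|lebesgue.
        \<tau> powr (\<rho> * (\<eta> + 1) - 1) / (x powr \<rho> - \<tau> powr \<rho>) powr (1 - \<alpha>) * \<phi> \<tau>)"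

definition katugampola_Lambda ::
  "real \<Rightarrow> real \<Rightarrow> real \<Rightarrow> real \<Rightarrow> real \<Rightarrow> real \<Rightarrow> real" where
  "katugampola_Lambda \<rho> \<beta> \<kappa> x \<alpha> \<eta> =
     Gamma (\<eta> + 1) / Gamma (\<eta> + \<alpha> + 1) * \<rho> powr (- \<beta>) * x powr (\<kappa> + \<rho> * (\<eta> + \<alpha>))"

end

theory Submission
  imports Defs
begin

text \<open>
  Up to the prefactor, the fractional integral is I(h) = integral of w h for a nonnegative kernel w.
  Up to the same prefactor, \<Lambda> is W = I(1), a Beta integral after u = (\<tau> / x) powr \<rho>.
  The Gruss functional W I(fg) - I(f) I(g) does not change when f and g are replaced by
  f - m and g - p; after this shift both products lie between 0 and W^2 (M - m) (P - p), hence
  so does the absolute value of their difference.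
\<close>

text \<open>Since \<open>U\<close>, \<open>V\<close> and \<open>A\<close> below integrate
  nonnegative functions bounded by constants, comparing each with that constant times the total mass
  \<open>W\<close> suffices. An arbitrary measure space allows the later use on
  \<open>{0..x}\<close>, with the kernel as weight.\<close>

lemma weighted_Gruss:
  fixes w f g :: "'a \<Rightarrow> real" and a b c d :: real
  assumes w: "integrable M w" "\<And>t. t \<in> space M \<Longrightarrow> 0 \<le> w t"
    and meas [measurable]: "f \<in> borel_measurable M" "g \<in> borel_measurable M"
    and f: "\<And>t. t \<in> space M \<Longrightarrow> a \<le> f t \<and> f t \<le> b"
    and g: "\<And>t. t \<in> space M \<Longrightarrow> c \<le> g t \<and> g t \<le> d"
  shows "\<bar>(LINT t|M. w t) * (LINT t|M. w t * (f t * g t))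
            - (LINT t|M. w t * f t) * (LINT t|M. w t * g t)\<bar>
         \<le> (LINT t|M. w t)\<^sup>2 * (b - a) * (d - c)"
\<comment> \<open>A point of the space yields \<open>a \<le> b\<close> and \<open>c \<le> d\<close>,
  which the product bounds below require. On an empty space every integral is 0, and so are both
  sides.\<close>
proof (cases "space M = {}")
  case True
  then show ?thesis by (simp add: Bochner_Integration.integral_empty)
next
  case False
  then obtain t0 where "t0 \<in> space M" by blast
  then have ab: "a \<le> b" and cd: "c \<le> d" using f[of t0] g[of t0] by auto
  have wm [measurable]: "w \<in> borel_measurable M" using w(1) by simp
  \<comment> \<open>Domination by a multiple of the integrable weight makes \<open>w * h\<close>
    integrable for each bounded measurable \<open>h\<close>; this is applied to \<open>f\<close>,
    \<open>g\<close> and their product.\<close>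
  have bounded_mult: "integrable M (\<lambda>t. w t * h t)"
    if [measurable]: "h \<in> borel_measurable M" and "\<And>t. t \<in> space M \<Longrightarrow> \<bar>h t\<bar> \<le> B" for h B
  proof (rule Bochner_Integration.integrable_bound)
    show "integrable M (\<lambda>t. B * w t)" using w(1) by simp
    show "AE t in M. norm (w t * h t) \<le> norm (B * w t)"
    proof (rule AE_I2)
      fix t assume t: "t \<in> space M"
      have "\<bar>h t\<bar> \<le> \<bar>B\<bar>" using that(2)[OF t] by linarith
      then show "norm (w t * h t) \<le> norm (B * w t)"
        by (simp add: abs_mult mult.commute mult_right_mono)
    qed
  qed simp
  have absf: "\<bar>f t\<bar> \<le> \<bar>a\<bar> + \<bar>b\<bar>" and absg: "\<bar>g t\<bar> \<le> \<bar>c\<bar> + \<bar>d\<bar>" if "t \<in> space M" for t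
    using f[OF that] g[OF that] by linarith+
  have absfg: "\<bar>f t * g t\<bar> \<le> (\<bar>a\<bar> + \<bar>b\<bar>) * (\<bar>c\<bar> + \<bar>d\<bar>)" if "t \<in> space M" for t
    unfolding abs_mult by (intro mult_mono absf absg that) auto
  have wf: "integrable M (\<lambda>t. w t * f t)" by (rule bounded_mult[OF _ absf]) auto
  have wg: "integrable M (\<lambda>t. w t * g t)" by (rule bounded_mult[OF _ absg]) auto
  have wfg: "integrable M (\<lambda>t. w t * (f t * g t))" by (rule bounded_mult[OF _ absfg]) auto
  define W where "W = (LINT t|M. w t)"
  define U where "U = (LINT t|M. w t * (f t - a))"
  define V where "V = (LINT t|M. w t * (g t - c))"
  define A where "A = (LINT t|M. w t * ((f t - a) * (g t - c)))"
  have iU: "integrable M (\<lambda>t. w t * (f t - a))"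
    using wf w(1) by (simp add: right_diff_distrib)
  have iV: "integrable M (\<lambda>t. w t * (g t - c))"
    using wg w(1) by (simp add: right_diff_distrib)
  \<comment> \<open>Expanding under the integral sign gives both integrability and the value of
    \<open>A\<close> by linearity.\<close>
  have A_expand: "(\<lambda>t. w t * ((f t - a) * (g t - c))) =
      (\<lambda>t. w t * (f t * g t) - c * (w t * f t) - a * (w t * g t) + a * c * w t)"
    by (auto simp: algebra_simps)
  have iA: "integrable M (\<lambda>t. w t * ((f t - a) * (g t - c)))"
    unfolding A_expand using wf wg wfg w(1) by auto
  have U: "U = (LINT t|M. w t * f t) - a * W"
    unfolding U_def W_def using wf w(1) by (simp add: right_diff_distrib mult.commute)
  have V: "V = (LINT t|M. w t * g t) - c * W"
    unfolding V_def W_def using wg w(1) by (simp add: right_diff_distrib mult.commute)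
  have A: "A = (LINT t|M. w t * (f t * g t)) - c * (LINT t|M. w t * f t)
                 - a * (LINT t|M. w t * g t) + a * c * W"
    unfolding A_def A_expand W_def using wf wg wfg w(1) by simp
  \<comment> \<open>The shift adds the same terms to \<open>W * A\<close> and to
    \<open>U * V\<close>: \<open>- c W I(f) - a W I(g) + a c W^2\<close>, with \<open>I(h)\<close>
    the integral of \<open>w h\<close>. They cancel in the difference.\<close>
  have shift: "W * (LINT t|M. w t * (f t * g t))
      - (LINT t|M. w t * f t) * (LINT t|M. w t * g t) = W * A - U * V"
    unfolding U V A by (simp add: algebra_simps)
  have W0: "0 \<le> W" unfolding W_def by (rule integral_nonneg_AE) (use w in auto)
  have U0: "0 \<le> U" unfolding U_def by (rule integral_nonneg_AE) (use w f in auto)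
  have V0: "0 \<le> V" unfolding V_def by (rule integral_nonneg_AE) (use w g in auto)
  have A0: "0 \<le> A" unfolding A_def by (rule integral_nonneg_AE) (use w f g in auto)
  have "U \<le> (LINT t|M. w t * (b - a))" unfolding U_def
    by (rule integral_mono) (use iU w f in \<open>auto intro!: mult_left_mono\<close>)
  then have U1: "U \<le> W * (b - a)" by (simp add: W_def)
  have "V \<le> (LINT t|M. w t * (d - c))" unfolding V_def
    by (rule integral_mono) (use iV w g in \<open>auto intro!: mult_left_mono\<close>)
  then have V1: "V \<le> W * (d - c)" by (simp add: W_def)
  have "A \<le> (LINT t|M. w t * ((b - a) * (d - c)))" unfolding A_def
    by (rule integral_mono) (use iA w f g ab cd in \<open>auto intro!: mult_left_mono mult_mono\<close>)
  then have A1: "A \<le> W * ((b - a) * (d - c))" by (simp add: W_def)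
  have "U * V \<le> (W * (b - a)) * (W * (d - c))"
    using U1 V1 U0 V0 W0 ab by (intro mult_mono) auto
  moreover have "W * A \<le> W * (W * ((b - a) * (d - c)))" using A1 W0 by (rule mult_left_mono)
  moreover have "0 \<le> W * A" "0 \<le> U * V" using W0 A0 U0 V0 by auto
  \<comment> \<open>Two numbers in the interval from 0 to a common bound differ by at most that
    bound.\<close>
  ultimately have "\<bar>W * A - U * V\<bar> \<le> W\<^sup>2 * (b - a) * (d - c)"
    by (simp add: power2_eq_square mult_ac abs_le_iff)
  then show ?thesis using shift by (simp add: W_def)
qed

text \<open>Under the substitution \<open>u\<close> the kernel is a constant times the pullback of
  the Beta integrand. This settles integrability, despite possible singularities at 0 and
  \<open>x\<close>, together with the value.\<close>

lemma Katugampola_kernel_integral: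
  fixes \<alpha> \<rho> \<eta> x :: real
  assumes x: "0 < x" and \<alpha>: "0 < \<alpha>" and \<rho>: "0 < \<rho>" and \<eta>: "-1 < \<eta>"
  defines "w \<equiv> \<lambda>\<tau>. \<tau> powr (\<rho> * (\<eta> + 1) - 1) / (x powr \<rho> - \<tau> powr \<rho>) powr (1 - \<alpha>)"
  shows "set_integrable lebesgue {0..x} w"
    and "(LINT \<tau>:{0..x}|lebesgue. w \<tau>) = x powr (\<rho> * (\<eta> + \<alpha>)) / \<rho> * Beta (\<eta> + 1) \<alpha>"
proof -
  define F where "F = (\<lambda>t::real. t powr \<eta> * (1 - t) powr (\<alpha> - 1))"
  define u where "u = (\<lambda>\<tau>::real. (\<tau> / x) powr \<rho>)"
  define u' where "u' = (\<lambda>\<tau>::real. \<rho> * (\<tau> / x) powr (\<rho> - 1) / x)"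
  \<comment> \<open>The factor for which \<open>w = c * |u'| * F(u)\<close>: it restores the powers
    of \<open>x\<close> lost in scaling by \<open>x\<close> and cancels the \<open>\<rho>\<close> in
    \<open>u'\<close>.\<close>
  define c where "c = x powr (\<rho> * (\<eta> + \<alpha>)) / \<rho>"
  have "(F has_integral Beta (\<eta> + 1) \<alpha>) {0..1}"
    using has_integral_Beta_real[of "\<eta> + 1" \<alpha>] \<alpha> \<eta> by (simp add: F_def)
  \<comment> \<open>Open intervals avoid the endpoints, where \<open>u\<close> may fail to be
    differentiable and \<open>F\<close> may be singular; the endpoints form a null set.\<close>
  then have F: "(F has_integral Beta (\<eta> + 1) \<alpha>) {0<..<1}"
    by (simp add: has_integral_Icc_iff_Ioo)
  have absF: "F absolutely_integrable_on {0<..<1}"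
    by (rule nonnegative_absolutely_integrable_1) (use F in \<open>auto simp: F_def\<close>)
  have img: "u ` {0<..<x} = {0<..<1}"
  proof (intro equalityI subsetI)
    fix y assume "y \<in> u ` {0<..<x}"
    then obtain \<tau> where \<tau>: "0 < \<tau>" "\<tau> < x" "y = u \<tau>" by auto
    have "(\<tau> / x) powr \<rho> < 1 powr \<rho>"
      using \<tau> x \<rho> by (intro powr_less_mono2) auto
    then show "y \<in> {0<..<1}" using \<tau> x by (auto simp: u_def)
  next
    fix y :: real assume y: "y \<in> {0<..<1}"
    have "y powr (1 / \<rho>) < 1 powr (1 / \<rho>)" using y \<rho> by (intro powr_less_mono2) auto
    \<comment> \<open>The witness is the value at \<open>y\<close> of the inverse of
      \<open>u\<close>.\<close>
    then have "x * y powr (1 / \<rho>) \<in> {0<..<x}" using x y by auto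
    moreover have "u (x * y powr (1 / \<rho>)) = y" using x y \<rho> by (simp add: u_def powr_powr)
    ultimately show "y \<in> u ` {0<..<x}" by (metis imageI)
  qed
  have inj: "inj_on u {0<..<x}"
  proof (rule inj_onI)
    fix s t assume "s \<in> {0<..<x}" "t \<in> {0<..<x}" "u s = u t"
    then show "s = t" using x \<rho> powr_inj[of "s / x" \<rho> "t / x"]
      by (smt (verit) divide_cancel_right divide_pos_pos greaterThanLessThan_iff powr_less_mono2 u_def)
  qed
  have der: "(u has_field_derivative u' \<tau>) (at \<tau> within {0<..<x})" if "\<tau> \<in> {0<..<x}" for \<tau>
    unfolding u_def u'_def using that x
    by (auto intro!: derivative_eq_intros)
  have transform: "c * (\<bar>u' \<tau>\<bar> * F (u \<tau>)) = w \<tau>" if "\<tau> \<in> {0<..<x}" for \<tau>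
  proof -
    have t: "0 < \<tau>" "\<tau> < x" using that by auto
    have pos: "0 < x powr \<rho> - \<tau> powr \<rho>" using t \<rho> by (simp add: powr_less_mono2)
    have "1 - u \<tau> = (x powr \<rho> - \<tau> powr \<rho>) / x powr \<rho>"
      using t x by (simp add: u_def powr_divide diff_divide_distrib)
    then have e1: "(1 - u \<tau>) powr (\<alpha> - 1)
        = (x powr \<rho> - \<tau> powr \<rho>) powr (\<alpha> - 1) / x powr (\<rho> * (\<alpha> - 1))"
      using t x pos by (simp add: powr_divide powr_powr)
    have e2: "u \<tau> powr \<eta> = \<tau> powr (\<rho> * \<eta>) / x powr (\<rho> * \<eta>)"
      using t x by (simp add: u_def powr_powr powr_divide)
    have e3: "\<bar>u' \<tau>\<bar> = \<rho> * (\<tau> powr (\<rho> - 1) / x powr \<rho>)"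
      using t x \<rho> by (simp add: u'_def powr_divide powr_diff)
    \<comment> \<open>The three factors are the denominators in \<open>e3\<close>, \<open>e2\<close>
      and \<open>e1\<close>.\<close>
    have e4: "x powr (\<rho> * (\<eta> + \<alpha>)) = x powr \<rho> * x powr (\<rho> * \<eta>) * x powr (\<rho> * (\<alpha> - 1))"
      by (simp add: powr_add [symmetric] algebra_simps)
    have e5: "\<tau> powr (\<rho> * (\<eta> + 1) - 1) = \<tau> powr (\<rho> - 1) * \<tau> powr (\<rho> * \<eta>)"
      by (simp add: powr_add [symmetric] algebra_simps)
    have e6: "w \<tau> = \<tau> powr (\<rho> * (\<eta> + 1) - 1) * (x powr \<rho> - \<tau> powr \<rho>) powr (\<alpha> - 1)"
      by (simp add: w_def divide_inverse powr_minus [symmetric])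
    show ?thesis
      unfolding c_def F_def e6 e1 e2 e3 e4 e5 using x \<rho> by (simp add: field_simps)
  qed
  \<comment> \<open>The change of variables theorem is an equivalence, read here from
    \<open>F\<close> on the image \<open>{0<..<1}\<close> back to the pullback on
    \<open>{0<..<x}\<close>.\<close>
  have sub: "(\<lambda>\<tau>. \<bar>u' \<tau>\<bar> * F (u \<tau>)) absolutely_integrable_on {0<..<x} \<and>
      integral {0<..<x} (\<lambda>\<tau>. \<bar>u' \<tau>\<bar> * F (u \<tau>)) = Beta (\<eta> + 1) \<alpha>"
    using has_absolute_integral_change_of_variables_1'[OF _ der inj, of F "Beta (\<eta> + 1) \<alpha>"]
      absF F by (auto simp: img integral_unique)
  have "(\<lambda>\<tau>. c * (\<bar>u' \<tau>\<bar> * F (u \<tau>))) absolutely_integrable_on {0<..<x}"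
    using sub by (intro set_integrable_mult_right) auto
  then have w_abs: "w absolutely_integrable_on {0<..<x}"
    by (rule set_integrable_cong[THEN iffD1, rotated -1]) (use transform in auto)
  then show w_int: "set_integrable lebesgue {0..x} w"
    by (simp add: absolutely_integrable_on_Icc_iff_Ioo)
  have "integral {0<..<x} w = integral {0<..<x} (\<lambda>\<tau>. c * (\<bar>u' \<tau>\<bar> * F (u \<tau>)))"
    by (rule Henstock_Kurzweil_Integration.integral_cong) (simp add: transform)
  also have "\<dots> = c * Beta (\<eta> + 1) \<alpha>" using sub by simp
  finally show "(LINT \<tau>:{0..x}|lebesgue. w \<tau>) = x powr (\<rho> * (\<eta> + \<alpha>)) / \<rho> * Beta (\<eta> + 1) \<alpha>"
    using set_lebesgue_integral_eq_integral(2)[OF w_int]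
    by (simp add: c_def integral_open_interval_real)
qed

theorem theorem1:
  fixes f g :: "real \<Rightarrow> real"
    and m M p P \<alpha> \<beta> \<rho> \<eta> \<kappa> x :: real
  assumes "set_integrable lebesgue {0..} f"
    and "set_integrable lebesgue {0..} g"
    and "\<And>t. t \<ge> 0 \<Longrightarrow> m \<le> f t \<and> f t \<le> M"
    and "\<And>t. t \<ge> 0 \<Longrightarrow> p \<le> g t \<and> g t \<le> P"
    and "x > 0" and "\<alpha> > 0" and "\<rho> > 0" and "\<eta> \<ge> 0"
  shows "\<bar>katugampola_Lambda \<rho> \<beta> \<kappa> x \<alpha> \<eta> * katugampola_integral \<rho> \<alpha> \<beta> \<eta> \<kappa> (\<lambda>t. f t * g t) x
           - katugampola_integral \<rho> \<alpha> \<beta> \<eta> \<kappa> f x * katugampola_integral \<rho> \<alpha> \<beta> \<eta> \<kappa> g x\<bar>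
         \<le> (katugampola_Lambda \<rho> \<beta> \<kappa> x \<alpha> \<eta>)\<^sup>2 * (M - m) * (P - p)"
proof -
  define w where "w = (\<lambda>\<tau>. \<tau> powr (\<rho> * (\<eta> + 1) - 1) / (x powr \<rho> - \<tau> powr \<rho>) powr (1 - \<alpha>))"
  define C where "C = \<rho> powr (1 - \<beta>) * x powr \<kappa> / Gamma \<alpha>"
  \<comment> \<open>Every point of the space of \<open>L\<close> is nonnegative, so the bounds on
    \<open>f\<close> and \<open>g\<close> hold on all of it, as \<open>weighted_Gruss\<close>
    demands.\<close>
  define L where "L = lebesgue_on {0..x}"
  define D where "D = (LINT t|L. w t) * (LINT t|L. w t * (f t * g t))
      - (LINT t|L. w t * f t) * (LINT t|L. w t * g t)"
  have set_int: "(LINT t:{0..x}|lebesgue. h t) = (LINT t|L. h t)" for h :: "real \<Rightarrow> real"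
    by (simp add: L_def set_lebesgue_integral_def integral_restrict_space)
  have K: "katugampola_integral \<rho> \<alpha> \<beta> \<eta> \<kappa> h x = C * (LINT t|L. w t * h t)" for h
    by (simp add: katugampola_integral_def C_def w_def set_int)
  have w_int: "set_integrable lebesgue {0..x} w"
    and w_val: "(LINT t|L. w t) = x powr (\<rho> * (\<eta> + \<alpha>)) / \<rho> * Beta (\<eta> + 1) \<alpha>"
    using Katugampola_kernel_integral[of x \<alpha> \<rho> \<eta>] assms(5-8) by (simp_all add: w_def set_int)
  have Gamma_nz: "Gamma \<alpha> \<noteq> 0" using Gamma_real_pos[OF \<open>\<alpha> > 0\<close>] by linarith
  \<comment> \<open>Writing Beta through Gamma, the factor \<open>Gamma \<alpha>\<close> cancels
    against the denominator of \<open>C\<close>, and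
    \<open>\<rho> powr (1 - \<beta>) / \<rho>\<close> becomes
    \<open>\<rho> powr (- \<beta>)\<close>.\<close>
  have \<Lambda>: "katugampola_Lambda \<rho> \<beta> \<kappa> x \<alpha> \<eta> = C * (LINT t|L. w t)"
    using assms(5-8)
    by (simp add: Gamma_nz katugampola_Lambda_def C_def w_val Beta_def powr_diff powr_minus powr_add
        field_simps)
  \<comment> \<open>Integrability on the half-line restricts to \<open>{0..x}\<close> and brings
    measurability with it.\<close>
  have meas: "h \<in> borel_measurable L" if "set_integrable lebesgue {0..} h" for h :: "real \<Rightarrow> real"
  proof -
    have "set_integrable lebesgue {0..x} h"
      using that by (rule set_integrable_subset) auto
    then have "integrable L h"
      by (simp add: L_def set_integrable_def integrable_restrict_space)
    then show ?thesis by simp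
  qed
  have "\<bar>D\<bar> \<le> (LINT t|L. w t)\<^sup>2 * (M - m) * (P - p)"
    unfolding D_def
  proof (rule weighted_Gruss)
    show "integrable L w"
      using w_int by (simp add: L_def set_integrable_def integrable_restrict_space)
  qed (use assms meas in \<open>auto simp: L_def w_def space_restrict_space\<close>)
  \<comment> \<open>Each product of two terms carries the prefactor \<open>C\<close> twice. The
    square is nonnegative, so it scales the bound and moves inside the absolute value.\<close>
  then have "C\<^sup>2 * \<bar>D\<bar> \<le> C\<^sup>2 * ((LINT t|L. w t)\<^sup>2 * (M - m) * (P - p))"
    by (rule mult_left_mono) simp
  moreover have "katugampola_Lambda \<rho> \<beta> \<kappa> x \<alpha> \<eta> * katugampola_integral \<rho> \<alpha> \<beta> \<eta> \<kappa> (\<lambda>t. f t * g t) x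
      - katugampola_integral \<rho> \<alpha> \<beta> \<eta> \<kappa> f x * katugampola_integral \<rho> \<alpha> \<beta> \<eta> \<kappa> g x = C\<^sup>2 * D"
    unfolding \<Lambda> K D_def by (simp add: power2_eq_square algebra_simps)
  ultimately show ?thesis
    by (simp add: \<Lambda> abs_mult power_mult_distrib mult.assoc)
qed

end
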